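(* For any $n$-vertex weighted graph $G=(V,w)$ and any $\tau\in\mathbb{R}$ with $0\le\tau\le\lambda(G)$, we have $\textrm{at-least-}\tau\textrm{-cert}(G)=\tau\textrm{-cut-rank}(G)$.
   Context: Identify $V$ with $\{1,\dots,n\}$; $w\in\mathbb{R}^{\binom{n}{2}}$ is the non-negative weight vector indexed by the 2-element subsets of $V$. For $\emptyset\ne S\subsetneq V$, $\Delta_G(S)$ is the set of edges (pairs of positive weight) with exactly one endpoint in $S$, $w(\Delta_G(S))$ its total weight, and $\lambda(G)=\min_S w(\Delta_G(S))$. For $0\le\tau\le\lambda(G)$, $\textrm{at-least-}\tau\textrm{-cert}(G)$ is the least $k$ such that there exists $A\in\mathbb{R}^{k\times\binom{n}{2}}$ with the property that every graph $G'=(V,w')$ with $w'\ge0$ and $Aw=Aw'$ satisfies $\lambda(G')\ge\tau$. The universal cut-edge incidence matrix $M_n$ is the Boolean $(2^{n-1}-1)\times\binom{n}{2}$ matrix with rows indexed by non-empty $S\subseteq\{1,\dots,n\}$ with $1\notin S$, columns indexed by 2-element subsets $e$, and $M_n(S,e)=1$ iff $e$ has exactly one endpoint in $S$. $\tau\textrm{-cut-rank}(G)$ is the minimum of $\mathrm{rank}(X)$ over real $(2^{n-1}-1)\times\binom{n}{2}$ matrices $X$ satisfying $X\le M_n$ entrywise and $Xw\ge\tau$ entrywise. *)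

theory Defs
  imports Complex_Main "Jordan_Normal_Form.Matrix" "Jordan_Normal_Form.DL_Rank"
begin

text \<open>
  A weighted graph on the vertex set \<open>{1..n}\<close> is given by a function \<open>w\<close> on the 2-element
  subsets of \<open>{1..n}\<close>; the values of \<open>w\<close> on all other sets are irrelevant.
\<close>

definition vertex_pairs :: "nat \<Rightarrow> nat set set" where
  "vertex_pairs n = {e. e \<subseteq> {1..n} \<and> card e = 2}"

definition nonneg_weights :: "nat \<Rightarrow> (nat set \<Rightarrow> real) \<Rightarrow> bool" where
  "nonneg_weights n w \<longleftrightarrow> (\<forall>e \<in> vertex_pairs n. 0 \<le> w e)"

definition edges :: "nat \<Rightarrow> (nat set \<Rightarrow> real) \<Rightarrow> nat set set" where
  "edges n w = {e \<in> vertex_pairs n. 0 < w e}"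

definition cut_edges :: "nat \<Rightarrow> (nat set \<Rightarrow> real) \<Rightarrow> nat set \<Rightarrow> nat set set" where
  "cut_edges n w S = {e \<in> edges n w. card (e \<inter> S) = 1}"

definition cut_weight :: "nat \<Rightarrow> (nat set \<Rightarrow> real) \<Rightarrow> nat set \<Rightarrow> real" where
  "cut_weight n w S = sum w (cut_edges n w S)"

text \<open>For \<open>n < 2\<close> there is no cut, so the minimum is meaningful only for \<open>n \<ge> 2\<close>.\<close>

definition min_cut :: "nat \<Rightarrow> (nat set \<Rightarrow> real) \<Rightarrow> real" where
  "min_cut n w = Min (cut_weight n w ` {S. S \<noteq> {} \<and> S \<subset> {1..n}})"

text \<open>
  Matrices are indexed by natural numbers, so the 2-element subsets of \<open>{1..n}\<close> (columns)
  and the non-empty subsets of \<open>{2..n}\<close> (rows) are enumerated in a fixed order.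
\<close>

definition pair_list :: "nat \<Rightarrow> nat set list" where
  "pair_list n = concat (map (\<lambda>i. map (\<lambda>j. {i, j}) [Suc i..<Suc n]) [1..<Suc n])"

definition cut_list :: "nat \<Rightarrow> nat set list" where
  "cut_list n = filter (\<lambda>S. S \<noteq> {}) (map set (subseqs [2..<Suc n]))"

lemma set_pair_list: "set (pair_list n) = vertex_pairs n"
proof
  have eq: "set (pair_list n) = (\<Union>i \<in> {1..<Suc n}. (\<lambda>j. {i, j}) ` {Suc i..<Suc n})"
    by (simp add: pair_list_def del: upt_Suc)
  show "set (pair_list n) \<subseteq> vertex_pairs n"
  proof
    fix e assume "e \<in> set (pair_list n)"
    then obtain i j where "e = {i, j}" "1 \<le> i" "i < j" "j \<le> n"
      unfolding eq by fastforce
    thus "e \<in> vertex_pairs n"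
      by (simp add: vertex_pairs_def)
  qed
  show "vertex_pairs n \<subseteq> set (pair_list n)"
  proof
    fix e assume "e \<in> vertex_pairs n"
    hence sub: "e \<subseteq> {1..n}" and "card e = 2"
      by (simp_all add: vertex_pairs_def)
    from this(2) obtain x y where e: "e = {x, y}" "x \<noteq> y"
      unfolding card_2_iff by blast
    have mem: "{a, b} \<in> set (pair_list n)" if "a < b" "1 \<le> a" "b \<le> n" for a b
      unfolding eq
    proof (rule UN_I)
      show "a \<in> {1..<Suc n}" using that by simp
      show "{a, b} \<in> (\<lambda>j. {a, j}) ` {Suc a..<Suc n}" using that by (intro imageI) simp
    qed
    have bounds: "1 \<le> x" "x \<le> n" "1 \<le> y" "y \<le> n"
      using sub e(1) by simp_all
    show "e \<in> set (pair_list n)"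
    proof (cases "x < y")
      case True
      thus ?thesis using mem[of x y] bounds e(1) by simp
    next
      case False
      hence "y < x" using e(2) by simp
      thus ?thesis using mem[of y x] bounds e(1) by (simp add: insert_commute)
    qed
  qed
qed

lemma length_pair_list: "length (pair_list n) = n choose 2"
proof -
  have "length (pair_list n) = (\<Sum>i\<leftarrow>[1..<Suc n]. n - i)"
    by (simp add: pair_list_def length_concat comp_def del: upt_Suc)
  also have "\<dots> = (\<Sum>i = Suc 0..<Suc n. n - i)"
    by (simp add: interv_sum_list_conv_sum_set_nat del: upt_Suc)
  also have "\<dots> = (\<Sum>i<n. n - Suc i)"
    by (simp only: sum.shift_bounds_Suc_ivl lessThan_atLeast0)
  also have "\<dots> = (\<Sum>i<n. i)"
    by (rule sum.nat_diff_reindex)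
  also have "\<dots> = n choose 2"
    by (induction n) (simp_all add: numeral_2_eq_2)
  finally show ?thesis .
qed

lemma distinct_pair_list: "distinct (pair_list n)"
proof (rule card_distinct)
  show "card (set (pair_list n)) = length (pair_list n)"
    using n_subsets[of "{1..n}" 2]
    by (simp add: set_pair_list length_pair_list vertex_pairs_def)
qed

lemma set_cut_list: "set (cut_list n) = {S. S \<noteq> {} \<and> S \<subseteq> {1..n} \<and> 1 \<notin> S}"
proof -
  have "{2..<Suc n} = {1..n} - {1}" by auto
  hence "Pow {2..<Suc n} = {S. S \<subseteq> {1..n} \<and> 1 \<notin> S}" by auto
  moreover have "set (cut_list n) = {S \<in> Pow {2..<Suc n}. S \<noteq> {}}"
    by (simp only: cut_list_def set_filter set_map subseqs_powset set_upt)
  ultimately have "set (cut_list n) = {S \<in> {S. S \<subseteq> {1..n} \<and> 1 \<notin> S}. S \<noteq> {}}"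
    by (simp only:)
  also have "\<dots> = {S. S \<noteq> {} \<and> S \<subseteq> {1..n} \<and> 1 \<notin> S}"
    by blast
  finally show ?thesis .
qed

lemma distinct_cut_list: "distinct (cut_list n)"
  by (simp add: cut_list_def distinct_set_subseqs)

lemma length_cut_list: "length (cut_list n) = 2 ^ (n - 1) - 1"
proof -
  have *: "set (cut_list n) = Pow {2..n} - {{}}"
  proof (rule Set.set_eqI)
    fix S :: "nat set"
    have "{1..n} - {1} = {2..n}" by auto
    hence "S \<subseteq> {2..n} \<longleftrightarrow> S \<subseteq> {1..n} \<and> 1 \<notin> S" by blast
    thus "S \<in> set (cut_list n) \<longleftrightarrow> S \<in> Pow {2..n} - {{}}"
      unfolding set_cut_list by blast
  qed
  have "length (cut_list n) = card (set (cut_list n))"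
    by (simp add: distinct_card distinct_cut_list)
  also have "\<dots> = 2 ^ (n - 1) - 1"
    unfolding * by (simp add: card_Diff_singleton card_Pow)
  finally show ?thesis .
qed

definition weight_vec :: "nat \<Rightarrow> (nat set \<Rightarrow> real) \<Rightarrow> real vec" where
  "weight_vec n w = vec (n choose 2) (\<lambda>j. w (pair_list n ! j))"

definition at_least_certifies ::
    "nat \<Rightarrow> (nat set \<Rightarrow> real) \<Rightarrow> real \<Rightarrow> real mat \<Rightarrow> bool" where
  "at_least_certifies n w \<tau> A \<longleftrightarrow>
    (\<forall>w'. nonneg_weights n w' \<and> A *\<^sub>v weight_vec n w = A *\<^sub>v weight_vec n w'
      \<longrightarrow> \<tau> \<le> min_cut n w')"

text \<open>The value \<open>k = 0\<close> (no query at all) is allowed; it is the minimum for \<open>\<tau> = 0\<close>.\<close>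

definition at_least_cert :: "nat \<Rightarrow> (nat set \<Rightarrow> real) \<Rightarrow> real \<Rightarrow> nat" where
  "at_least_cert n w \<tau> =
    (LEAST k. \<exists>A \<in> carrier_mat k (n choose 2). at_least_certifies n w \<tau> A)"

definition cut_matrix :: "nat \<Rightarrow> real mat" where
  "cut_matrix n = mat (2 ^ (n - 1) - 1) (n choose 2)
    (\<lambda>(i, j). if card (pair_list n ! j \<inter> cut_list n ! i) = 1 then 1 else 0)"

text \<open>
  On matrices and vectors \<open>\<le>\<close> is the entrywise order. The first argument of
  \<open>vec_space.rank\<close> is the number of rows.
\<close>

definition cut_rank :: "nat \<Rightarrow> (nat set \<Rightarrow> real) \<Rightarrow> real \<Rightarrow> nat" where
  "cut_rank n w \<tau> =
    (LEAST r. \<exists>X \<in> carrier_mat (2 ^ (n - 1) - 1) (n choose 2).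
      X \<le> cut_matrix n \<and>
      vec (2 ^ (n - 1) - 1) (\<lambda>_. \<tau>) \<le> X *\<^sub>v weight_vec n w \<and>
      r = vec_space.rank (2 ^ (n - 1) - 1) X)"

end

theory Submission
  imports Defs
begin

text \<open>
  If \<open>X\<close> is admissible for the cut rank and \<open>X = C D\<close> is a rank factorization, then \<open>D\<close> is a
  certificate: for \<open>w' \<ge> 0\<close> with \<open>D w' = D w\<close>, the cut weights of \<open>w'\<close> dominate
  \<open>X w' = X w \<ge> \<tau>\<close>. Conversely, a certificate \<open>A\<close> bounds below by \<open>\<tau>\<close> the minimum of each cut
  weight over \<open>{w' \<ge> 0. A w' = A w}\<close>, and the dual solutions \<open>y\<close> of these linear programs,
  taken as the rows of \<open>Y\<close>, give an admissible matrix \<open>X = Y A\<close>, whose rank is at most the number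
  of rows of \<open>A\<close>. Duality is derived from Farkas' lemma, which is proved by Bartl's induction on
  the number of inequalities.
\<close>

section \<open>Farkas' lemma and linear programming duality\<close>

text \<open>When an inequality \<open>m\<close> is added, either the old ones already imply the
  conclusion and \<open>m\<close> gets multiplier 0, or some \<open>x0\<close> satisfies the old
  ones and violates the conclusion. Projecting along \<open>x0\<close> onto the kernel of
  \<open>a m\<close> then eliminates \<open>m\<close>.\<close>

lemma farkas:
  fixes a :: "'i \<Rightarrow> 'j \<Rightarrow> real" and c :: "'j \<Rightarrow> real"
  assumes "finite I" and "finite J"
    and "\<And>x. (\<forall>i\<in>I. (\<Sum>j\<in>J. a i j * x j) \<le> 0) \<Longrightarrow> (\<Sum>j\<in>J. c j * x j) \<le> 0"
  shows "\<exists>u. (\<forall>i\<in>I. 0 \<le> u i) \<and> (\<forall>j\<in>J. c j = (\<Sum>i\<in>I. u i * a i j))"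
  using assms(1,3)
proof (induction I arbitrary: a c rule: finite_induct)
  case empty
  \<comment> \<open>Without constraints, \<open>c\<close> itself is a test point, which forces
    \<open>c\<close> to vanish on \<open>J\<close>.\<close>
  have "(\<Sum>j\<in>J. c j * c j) \<le> 0" using empty[of c] by simp
  moreover have "0 \<le> (\<Sum>j\<in>J. c j * c j)" by (simp add: sum_nonneg)
  ultimately have "(\<Sum>j\<in>J. c j * c j) = 0" by simp
  hence "\<forall>j\<in>J. c j * c j = 0" using assms(2) by (subst (asm) sum_nonneg_eq_0_iff) auto
  thus ?case by simp
next
  case (insert m I)
  show ?case
  proof (cases "\<forall>x. (\<forall>i\<in>I. (\<Sum>j\<in>J. a i j * x j) \<le> 0) \<longrightarrow> (\<Sum>j\<in>J. c j * x j) \<le> 0")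
    case True
    then obtain u where u: "\<forall>i\<in>I. 0 \<le> u i" "\<forall>j\<in>J. c j = (\<Sum>i\<in>I. u i * a i j)"
      using insert.IH[of a c] by blast
    have "(\<Sum>i\<in>I. (u(m := 0)) i * a i j) = (\<Sum>i\<in>I. u i * a i j)" for j
      using insert.hyps(2) by (intro sum.cong) auto
    with u show ?thesis
      using insert.hyps by (intro exI[of _ "u(m := 0)"]) auto
  next
    case False
    then obtain x0 where x0: "\<forall>i\<in>I. (\<Sum>j\<in>J. a i j * x0 j) \<le> 0" "0 < (\<Sum>j\<in>J. c j * x0 j)"
      by (meson not_le)
    define p where "p = (\<Sum>j\<in>J. a m j * x0 j)"
    \<comment> \<open>Since \<open>x0\<close> violates the conclusion but none of the inequalities
      in \<open>I\<close>, it must violate inequality \<open>m\<close>.\<close>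
    have p: "0 < p"
      using insert.prems[of x0] x0 unfolding p_def by (metis insert_iff not_le)
    \<comment> \<open>These ratios are chosen so that \<open>a i - \<alpha> i * a m\<close> and
      \<open>c - \<gamma> * a m\<close> vanish at \<open>x0\<close>.\<close>
    define \<alpha> where "\<alpha> i = (\<Sum>j\<in>J. a i j * x0 j) / p" for i
    define \<gamma> where "\<gamma> = (\<Sum>j\<in>J. c j * x0 j) / p"
    have dist: "(\<Sum>j\<in>J. (b j - a m j * \<beta>) * x j)
        = (\<Sum>j\<in>J. b j * x j) - \<beta> * (\<Sum>j\<in>J. a m j * x j)"
      "(\<Sum>j\<in>J. b j * (x j - \<beta> * x0 j))
        = (\<Sum>j\<in>J. b j * x j) - \<beta> * (\<Sum>j\<in>J. b j * x0 j)" for b x \<beta>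
      by (simp_all add: algebra_simps sum_subtractf sum_distrib_left)
    \<comment> \<open>Evaluating a corrected functional at \<open>x\<close> is the same as
      evaluating the original one at the projection of \<open>x\<close>.\<close>
    have lin: "(\<Sum>j\<in>J. (b j - a m j * ((\<Sum>j\<in>J. b j * x0 j) / p)) * x j)
        = (\<Sum>j\<in>J. b j * (x j - (\<Sum>j\<in>J. a m j * x j) / p * x0 j))"
      (is "?l = ?r") for b x
    proof -
      have "?l = (\<Sum>j\<in>J. b j * x j) - (\<Sum>j\<in>J. b j * x0 j) / p * (\<Sum>j\<in>J. a m j * x j)"
        by (rule dist(1))
      also have "\<dots> = (\<Sum>j\<in>J. b j * x j) - (\<Sum>j\<in>J. a m j * x j) / p * (\<Sum>j\<in>J. b j * x0 j)"
        by simp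
      also have "\<dots> = ?r"
        by (rule dist(2)[symmetric])
      finally show ?thesis .
    qed
    have "\<exists>u. (\<forall>i\<in>I. 0 \<le> u i)
        \<and> (\<forall>j\<in>J. c j - a m j * \<gamma> = (\<Sum>i\<in>I. u i * (a i j - a m j * \<alpha> i)))"
    proof (rule insert.IH)
      fix x assume x: "\<forall>i\<in>I. (\<Sum>j\<in>J. (a i j - a m j * \<alpha> i) * x j) \<le> 0"
      define x' where "x' j = x j - (\<Sum>j\<in>J. a m j * x j) / p * x0 j" for j
      have "(\<Sum>j\<in>J. a m j * x' j)
          = (\<Sum>j\<in>J. a m j * x j) - (\<Sum>j\<in>J. a m j * x j) / p * (\<Sum>j\<in>J. a m j * x0 j)"
        unfolding x'_def by (rule dist(2))
      also have "\<dots> = 0" using p unfolding p_def[symmetric] by simp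
      finally have "(\<Sum>j\<in>J. a m j * x' j) \<le> 0" by simp
      moreover have "\<forall>i\<in>I. (\<Sum>j\<in>J. a i j * x' j) \<le> 0"
        using x unfolding \<alpha>_def lin x'_def .
      ultimately have "(\<Sum>j\<in>J. c j * x' j) \<le> 0" by (intro insert.prems) simp
      thus "(\<Sum>j\<in>J. (c j - a m j * \<gamma>) * x j) \<le> 0"
        unfolding \<gamma>_def lin x'_def .
    qed
    then obtain u where u: "\<forall>i\<in>I. 0 \<le> u i"
      "\<forall>j\<in>J. c j - a m j * \<gamma> = (\<Sum>i\<in>I. u i * (a i j - a m j * \<alpha> i))" by blast
    \<comment> \<open>Expanding the combination found for the corrected functionals leaves
      \<open>a m\<close> with this coefficient. It is non-negative, as \<open>\<gamma>\<close> is
      positive and each \<open>\<alpha> i\<close> with \<open>i\<close> in \<open>I\<close> is at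
      most 0.\<close>
    define v where "v = u(m := \<gamma> - (\<Sum>i\<in>I. u i * \<alpha> i))"
    have eq: "(\<Sum>i\<in>I. v i * g i) = (\<Sum>i\<in>I. u i * g i)" for g
      unfolding v_def using insert.hyps(2) by (intro sum.cong) auto
    have "c j = (\<Sum>i\<in>insert m I. v i * a i j)" if "j \<in> J" for j
    proof -
      have "c j - a m j * \<gamma> = (\<Sum>i\<in>I. u i * a i j) - a m j * (\<Sum>i\<in>I. u i * \<alpha> i)"
        using u(2) that by (simp add: algebra_simps sum_subtractf sum_distrib_left)
      thus ?thesis
        using insert.hyps by (simp add: eq) (simp add: v_def algebra_simps)
    qed
    moreover have "0 \<le> v i" if "i \<in> insert m I" for i
    proof (cases "i = m")
      case True
      have "(\<Sum>i\<in>I. u i * \<alpha> i) \<le> 0"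
        using u(1) x0(1) p
        by (intro sum_nonpos) (simp add: \<alpha>_def mult_nonneg_nonpos divide_nonpos_pos)
      moreover have "0 \<le> \<gamma>" using x0(2) p by (simp add: \<gamma>_def)
      ultimately show ?thesis using True by (simp add: v_def)
    qed (use that u(1) in \<open>auto simp: v_def\<close>)
    ultimately show ?thesis by blast
  qed
qed

text \<open>Farkas' lemma is applied to the homogenized program: with an extra coordinate
  \<open>t\<close> scaling the right-hand side \<open>b\<close>, the constraints
  \<open>z \<ge> 0\<close>, \<open>t \<ge> 0\<close> and \<open>a z = t b\<close> imply
  \<open>t \<tau> \<le> c z\<close>. The resulting multipliers contain the dual solution.\<close>

lemma linear_program_dual:
  fixes a :: "'i \<Rightarrow> 'j \<Rightarrow> real" and c w :: "'j \<Rightarrow> real"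
  assumes fin: "finite I" "finite J"
    and w: "\<forall>j\<in>J. 0 \<le> w j"
    and opt: "\<And>x. \<forall>j\<in>J. 0 \<le> x j \<Longrightarrow>
      \<forall>i\<in>I. (\<Sum>j\<in>J. a i j * x j) = (\<Sum>j\<in>J. a i j * w j) \<Longrightarrow> \<tau> \<le> (\<Sum>j\<in>J. c j * x j)"
  shows "\<exists>y. (\<forall>j\<in>J. (\<Sum>i\<in>I. y i * a i j) \<le> c j)
    \<and> \<tau> \<le> (\<Sum>j\<in>J. (\<Sum>i\<in>I. y i * a i j) * w j)"
proof -
  define b where "b i = (\<Sum>j\<in>J. a i j * w j)" for i
  \<comment> \<open>The index \<open>None\<close> carries \<open>t\<close>. In \<open>a'\<close>,
    the rows \<open>Inl\<close> express non-negativity, and the two signs in \<open>Inr\<close>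
    split each equation into opposite inequalities.\<close>
  define J' where "J' = insert None (Some ` J)"
  define c' where "c' = case_option \<tau> (\<lambda>j. - c j)"
  define \<sigma> :: "bool \<Rightarrow> real" where "\<sigma> s = (if s then 1 else -1)" for s
  define a' where "a' = (\<lambda>r j. case r of
      Inl j' \<Rightarrow> if j = j' then -1 else 0
    | Inr (i, s) \<Rightarrow> \<sigma> s * case_option (- b i) (a i) j)"
  have fin': "finite J'" unfolding J'_def using fin by simp
  have sumJ': "(\<Sum>j\<in>J'. f j) = f None + (\<Sum>j\<in>J. f (Some j))" for f :: "'j option \<Rightarrow> real"
    unfolding J'_def using fin by (simp add: sum.reindex)
  have "\<exists>u. (\<forall>r\<in>J' <+> I \<times> UNIV. 0 \<le> u r)
      \<and> (\<forall>j\<in>J'. c' j = (\<Sum>r\<in>J' <+> I \<times> UNIV. u r * a' r j))"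
  proof (rule farkas)
    fix x :: "'j option \<Rightarrow> real"
    assume x: "\<forall>r\<in>J' <+> I \<times> UNIV. (\<Sum>j\<in>J'. a' r j * x j) \<le> 0"
    define t z where "t = x None" and "z = (\<lambda>j. x (Some j))"
    have "0 \<le> x j" if "j \<in> J'" for j
    proof -
      have "(\<Sum>j'\<in>J'. a' (Inl j) j' * x j') = (\<Sum>j'\<in>J'. if j = j' then - x j' else 0)"
        by (intro sum.cong) (auto simp: a'_def)
      also have "\<dots> = - x j" using that fin' by simp
      finally show ?thesis using bspec[OF x, of "Inl j"] that by auto
    qed
    hence t: "0 \<le> t" and z: "\<And>j. j \<in> J \<Longrightarrow> 0 \<le> z j" unfolding t_def z_def J'_def by auto
    have az: "(\<Sum>j\<in>J. a i j * z j) = t * b i" if "i \<in> I" for i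
    proof -
      have "\<sigma> s * ((\<Sum>j\<in>J. a i j * z j) - t * b i) \<le> 0" for s
        using bspec[OF x, OF InrI, of "(i, s)"] that
        by (simp add: sumJ' a'_def t_def z_def algebra_simps sum_distrib_left)
      from this[of True] this[of False] show ?thesis by (simp add: \<sigma>_def)
    qed
    have "t * \<tau> \<le> (\<Sum>j\<in>J. c j * z j)"
    proof (cases "t = 0")
      case False
      have "\<tau> \<le> (\<Sum>j\<in>J. c j * (z j / t))"
      proof (rule opt)
        show "\<forall>i\<in>I. (\<Sum>j\<in>J. a i j * (z j / t)) = (\<Sum>j\<in>J. a i j * w j)"
          using False az by (simp add: b_def flip: sum_divide_distrib)
      qed (use z t in auto)
      thus ?thesis using False t by (simp add: field_simps flip: sum_divide_distrib)
    next
      case True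
      \<comment> \<open>Now \<open>z\<close> is a recession direction of the feasible region, so the objective cannot
        decrease along \<open>z\<close>.\<close>
      have ray: "\<tau> \<le> (\<Sum>j\<in>J. c j * w j) + s * (\<Sum>j\<in>J. c j * z j)" if "0 \<le> s" for s
      proof -
        have "\<tau> \<le> (\<Sum>j\<in>J. c j * (w j + s * z j))"
        proof (rule opt)
          show "\<forall>i\<in>I. (\<Sum>j\<in>J. a i j * (w j + s * z j)) = (\<Sum>j\<in>J. a i j * w j)"
            using az True
            by (simp add: distrib_left sum.distrib mult.left_commute[of _ s] flip: sum_distrib_left)
        qed (use z w that in auto)
        thus ?thesis by (simp add: algebra_simps sum.distrib sum_distrib_left)
      qed
      have "0 \<le> (\<Sum>j\<in>J. c j * z j)"
      proof (rule ccontr)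
        define q where "q = (\<Sum>j\<in>J. c j * z j)"
        \<comment> \<open>A step of this length from \<open>w\<close> along \<open>z\<close> would
          bring the objective down to at most \<open>\<tau> - 1\<close>.\<close>
        define s where "s = (\<bar>(\<Sum>j\<in>J. c j * w j) - \<tau>\<bar> + 1) / (- q)"
        assume "\<not> 0 \<le> (\<Sum>j\<in>J. c j * z j)"
        hence q: "q < 0" by (simp add: q_def)
        hence "0 \<le> s" unfolding s_def by (intro divide_nonneg_pos) auto
        from ray[OF this] have "\<tau> \<le> (\<Sum>j\<in>J. c j * w j) + s * q" by (simp add: q_def)
        moreover have "s * q = - (\<bar>(\<Sum>j\<in>J. c j * w j) - \<tau>\<bar> + 1)"
          using q by (simp add: s_def)
        ultimately show False by linarith
      qed
      with True show ?thesis by simp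
    qed
    thus "(\<Sum>j\<in>J'. c' j * x j) \<le> 0"
      by (simp add: sumJ' c'_def t_def z_def sum_negf mult.commute)
  qed (use fin fin' in auto)
  then obtain u where u0: "\<forall>r\<in>J' <+> I \<times> UNIV. 0 \<le> u r"
    and u: "\<forall>j\<in>J'. c' j = (\<Sum>r\<in>J' <+> I \<times> UNIV. u r * a' r j)" by blast
  \<comment> \<open>The two multipliers of an equation combine into one of free sign. The
    \<open>Some\<close> coordinates then give dual feasibility and \<open>None\<close> gives the
    bound on the dual value, with the \<open>Inl\<close> multipliers as slack.\<close>
  define y where "y i = u (Inr (i, False)) - u (Inr (i, True))" for i
  have expand: "c' j = - u (Inl j) - (\<Sum>i\<in>I. y i * case_option (- b i) (a i) j)" if "j \<in> J'" for j
  proof -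
    have "(\<Sum>r\<in>J'. u (Inl r) * a' (Inl r) j) = (\<Sum>r\<in>J'. if j = r then - u (Inl r) else 0)"
      by (intro sum.cong) (auto simp: a'_def)
    also have "\<dots> = - u (Inl j)" using that fin' by simp
    finally have 1: "(\<Sum>r\<in>J'. u (Inl r) * a' (Inl r) j) = - u (Inl j)" .
    have "(\<Sum>r\<in>I \<times> UNIV. u (Inr r) * a' (Inr r) j)
        = (\<Sum>i\<in>I. \<Sum>s\<in>UNIV. u (Inr (i, s)) * a' (Inr (i, s)) j)"
      by (simp add: sum.cartesian_product)
    also have "\<dots> = (\<Sum>i\<in>I. - (y i * case_option (- b i) (a i) j))"
      by (intro sum.cong) (auto simp: UNIV_bool a'_def \<sigma>_def y_def algebra_simps)
    finally show ?thesis
      using bspec[OF u that] fin fin' 1 by (simp add: sum.Plus sum_negf)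
  qed
  have "(\<Sum>i\<in>I. y i * a i j) \<le> c j" if "j \<in> J" for j
  proof -
    have "0 \<le> u (Inl (Some j))" using u0 that unfolding J'_def by auto
    with expand[of "Some j"] that show ?thesis by (simp add: J'_def c'_def)
  qed
  moreover have "\<tau> \<le> (\<Sum>i\<in>I. y i * b i)"
  proof -
    have "0 \<le> u (Inl None)" using u0 unfolding J'_def by auto
    with expand[of None] show ?thesis by (simp add: J'_def c'_def sum_negf)
  qed
  moreover have "(\<Sum>i\<in>I. y i * b i) = (\<Sum>j\<in>J. (\<Sum>i\<in>I. y i * a i j) * w j)"
    unfolding b_def sum_distrib_left sum_distrib_right
    by (subst sum.swap) (simp add: mult.assoc)
  ultimately show ?thesis by auto
qed

section \<open>Rank of a product and rank factorization\<close>

text \<open>The columns of \<open>A * B\<close> lie in the span of the \<open>k\<close> columns of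
  \<open>A\<close>, so the replacement theorem bounds every independent set of them.\<close>

lemma (in vec_space) rank_mult_le:
  assumes A: "A \<in> carrier_mat n k" and B: "B \<in> carrier_mat k nc"
  shows "rank (A * B) \<le> k"
proof -
  have AB: "A * B \<in> carrier_mat n nc" using A B by simp
  obtain S where S: "maximal S (\<lambda>T. T \<subseteq> set (cols (A * B)) \<and> lin_indpt T)" "finite S"
    using maximal_exists_superset[of "set (cols (A * B))"
        "\<lambda>T. T \<subseteq> set (cols (A * B)) \<and> lin_indpt T" "{}"]
    by (auto simp: lin_dep_def)
  hence li: "lin_indpt S" and sub: "S \<subseteq> set (cols (A * B))" by (auto simp: maximal_def)
  have cA: "set (cols A) \<subseteq> carrier_vec n" using A cols_dim by blast
  have "set (cols (A * B)) \<subseteq> span (set (cols A))"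
  proof
    fix v assume "v \<in> set (cols (A * B))"
    then obtain j where j: "j < nc" "v = col (A * B) j"
      using A B by (auto simp: cols_def)
    from j(2) have "v = A *\<^sub>v col B j" using col_mult2[OF A B j(1)] by (rule trans)
    thus "v \<in> span (set (cols A))"
      using A B j(1) col_space_eq[OF A] unfolding col_space_def
      by (auto intro!: bexI[of _ "col B j"])
  qed
  with sub have "S \<subseteq> span (set (cols A))" by blast
  from replacement[OF S(2) _ _ li this] cA have "card S \<le> card (set (cols A))" by auto
  also have "\<dots> \<le> length (cols A)" by (rule card_length)
  also have "\<dots> = k" using A by simp
  finally show ?thesis using rank_card_indpt[OF AB S(1)] by simp
qed

text \<open>A maximal independent set of columns of \<open>X\<close> spans all of them. These form
  \<open>C\<close>, and the columns of \<open>D\<close> hold the coordinates of the columns of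
  \<open>X\<close>.\<close>

lemma (in vec_space) rank_factorization:
  assumes X: "X \<in> carrier_mat n nc"
  shows "\<exists>C\<in>carrier_mat n (rank X). \<exists>D\<in>carrier_mat (rank X) nc. X = C * D"
proof -
  obtain S where S: "maximal S (\<lambda>T. T \<subseteq> set (cols X) \<and> lin_indpt T)" "finite S"
    using maximal_exists_superset[of "set (cols X)" "\<lambda>T. T \<subseteq> set (cols X) \<and> lin_indpt T" "{}"]
    by (auto simp: lin_dep_def)
  have rank: "rank X = card S" using rank_card_indpt[OF X S(1)] .
  have li: "lin_indpt S" and sub: "S \<subseteq> set (cols X)" using S(1) by (auto simp: maximal_def)
  have cX: "set (cols X) \<subseteq> carrier_vec n" using X cols_dim by blast
  have cS: "S \<subseteq> carrier_vec n" using sub cX by blast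
  have in_span: "v \<in> span S" if v: "v \<in> set (cols X)" for v
  proof (rule ccontr)
    assume "v \<notin> span S"
    hence "v \<notin> S" using in_own_span[OF cS] by blast
    have "v \<in> carrier_vec n" using v cX by blast
    with \<open>v \<notin> S\<close> \<open>v \<notin> span S\<close> have "lin_indpt (S \<union> {v})"
      using lin_dep_iff_in_span[OF cS li] by simp
    with S(1) v sub have "S \<union> {v} = S"
      unfolding maximal_def by (metis Un_insert_right Un_upper1 insert_subset sup_bot_right)
    with \<open>v \<notin> S\<close> show False by blast
  qed
  obtain ss where ss: "set ss = S" "distinct ss" using S(2) finite_distinct_list by blast
  have len: "length ss = rank X" using ss rank distinct_card by metis
  define C where "C = mat_of_cols n ss"
  have C: "C \<in> carrier_mat n (rank X)" unfolding C_def using len mat_of_cols_carrier by metis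
  have "cols C = ss" unfolding C_def using ss cS by (intro cols_mat_of_cols) auto
  hence "\<exists>x\<in>carrier_vec (rank X). C *\<^sub>v x = col X j" if "j < nc" for j
    using in_span[of "col X j"] that X col_space_eq[OF C] ss(1) C
    unfolding col_space_def by (auto simp: cols_def)
  then obtain x where x: "\<And>j. j < nc \<Longrightarrow> x j \<in> carrier_vec (rank X) \<and> C *\<^sub>v x j = col X j"
    by metis
  define D where "D = mat_of_cols (rank X) (map x [0..<nc])"
  have D: "D \<in> carrier_mat (rank X) nc"
    unfolding D_def using mat_of_cols_carrier(1)[of "rank X" "map x [0..<nc]"] by simp
  have "X = C * D"
  proof (rule mat_col_eqI)
    fix j assume "j < dim_col (C * D)"
    hence j: "j < nc" using D by simp
    have "col D j = x j" unfolding D_def using j x by (simp add: col_mat_of_cols)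
    thus "col X j = col (C * D) j" using col_mult2[OF C D j] x[OF j] by (simp only:)
  qed (use X C D in auto)
  with C D show ?thesis by blast
qed

section \<open>Cut weights and the cut matrix\<close>

lemma card_Int_Compl_eq_1_iff:
  assumes "e \<subseteq> V" "card e = 2"
  shows "card (e \<inter> (V - S)) = 1 \<longleftrightarrow> card (e \<inter> S) = 1"
proof -
  have "finite e" using assms(2) card.infinite by fastforce
  moreover have "e \<inter> (V - S) = e - S" using assms(1) by blast
  ultimately show ?thesis
    using card_Int_Diff[of e S] assms(2) by auto
qed

lemma cut_weight_Compl: "cut_weight n w ({1..n} - S) = cut_weight n w S"
proof -
  have "cut_edges n w ({1..n} - S) = cut_edges n w S"
    using card_Int_Compl_eq_1_iff unfolding cut_edges_def edges_def vertex_pairs_def by blast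
  thus ?thesis by (simp add: cut_weight_def)
qed

text \<open>A cut and its complement have the same weight, so it suffices to test the sides that
  avoid vertex 1.\<close>

lemma le_min_cut_iff:
  assumes "2 \<le> n"
  shows "\<tau> \<le> min_cut n w \<longleftrightarrow> (\<forall>S\<in>set (cut_list n). \<tau> \<le> cut_weight n w S)"
proof -
  let ?C = "{S. S \<noteq> {} \<and> S \<subset> {1..n}}"
  have "finite ?C" by (rule finite_subset[of _ "Pow {1..n}"]) auto
  \<comment> \<open>\<open>Min\<close> is meaningful only over a nonempty family; with at least two
    vertices, \<open>{1}\<close> is a proper subset.\<close>
  moreover have "{1} \<in> ?C"
  proof -
    have "1 \<in> {1..n}" "2 \<in> {1..n}" "2 \<notin> {1::nat}" using assms by simp_all
    thus ?thesis by blast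
  qed
  ultimately have "\<tau> \<le> min_cut n w \<longleftrightarrow> (\<forall>S\<in>?C. \<tau> \<le> cut_weight n w S)"
    unfolding min_cut_def using Min_ge_iff[of "cut_weight n w ` ?C" \<tau>]
    by (simp only: finite_imageI image_is_empty ball_simps(9)) blast
  also have "\<dots> \<longleftrightarrow> (\<forall>S\<in>set (cut_list n). \<tau> \<le> cut_weight n w S)"
  proof (intro iffI ballI)
    fix S assume S: "\<forall>S\<in>?C. \<tau> \<le> cut_weight n w S" "S \<in> set (cut_list n)"
    have "1 \<in> {1..n}" using assms by simp
    with S(2) have "S \<in> ?C" by (auto simp: set_cut_list)
    with S(1) show "\<tau> \<le> cut_weight n w S" by (rule bspec)
  next
    fix S assume S: "\<forall>S\<in>set (cut_list n). \<tau> \<le> cut_weight n w S" "S \<in> ?C"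
    show "\<tau> \<le> cut_weight n w S"
    proof (cases "1 \<in> S")
      case True
      with S(2) have "{1..n} - S \<in> set (cut_list n)" by (auto simp: set_cut_list)
      with S(1) have "\<tau> \<le> cut_weight n w ({1..n} - S)" by (rule bspec)
      thus ?thesis by (simp only: cut_weight_Compl)
    next
      case False
      with S(2) have "S \<in> set (cut_list n)" by (auto simp: set_cut_list)
      with S(1) show ?thesis by (rule bspec)
    qed
  qed
  finally show ?thesis .
qed

lemma cut_matrix_carrier: "cut_matrix n \<in> carrier_mat (2 ^ (n - 1) - 1) (n choose 2)"
  by (simp add: cut_matrix_def)

lemma weight_vec_carrier [simp]: "weight_vec n w \<in> carrier_vec (n choose 2)"
  by (simp add: weight_vec_def)

lemma pair_list_nth: "j < n choose 2 \<Longrightarrow> pair_list n ! j \<in> vertex_pairs n"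
  using nth_mem[of j "pair_list n"] by (simp add: length_pair_list set_pair_list)

lemma sum_vertex_pairs: "(\<Sum>e\<in>vertex_pairs n. f e) = (\<Sum>j<n choose 2. f (pair_list n ! j))"
  using bij_betw_nth[OF distinct_pair_list, of "{..<n choose 2}" n "vertex_pairs n"]
  by (intro sum.reindex_bij_betw[symmetric]) (simp add: length_pair_list set_pair_list)

lemma mat_mult_vec_index_sum:
  assumes "A \<in> carrier_mat m k" "v \<in> carrier_vec k" "i < m"
  shows "(A *\<^sub>v v) $ i = (\<Sum>j<k. A $$ (i, j) * v $ j)"
  using assms by (auto simp: scalar_prod_def atLeast0LessThan intro!: sum.cong)

text \<open>The matrix counts all crossing pairs, \<open>cut_edges\<close> only those of positive
  weight. By non-negativity the remaining pairs have weight 0.\<close>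

lemma cut_matrix_mult_weight_vec:
  assumes "nonneg_weights n w" and i: "i < 2 ^ (n - 1) - 1"
  shows "(cut_matrix n *\<^sub>v weight_vec n w) $ i = cut_weight n w (cut_list n ! i)"
proof -
  let ?S = "cut_list n ! i"
  have fin: "finite (vertex_pairs n)" by (metis List.finite_set set_pair_list)
  have "cut_weight n w ?S = (\<Sum>e\<in>vertex_pairs n. if card (e \<inter> ?S) = 1 then w e else 0)"
    unfolding cut_weight_def cut_edges_def edges_def using assms(1) fin
    by (intro sum.mono_neutral_cong_left) (auto simp: nonneg_weights_def order.order_iff_strict)
  also have "\<dots> = (\<Sum>j<n choose 2. cut_matrix n $$ (i, j) * weight_vec n w $ j)"
    unfolding sum_vertex_pairs using i
    by (intro sum.cong) (auto simp: cut_matrix_def weight_vec_def)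
  also have "\<dots> = (cut_matrix n *\<^sub>v weight_vec n w) $ i"
    using mat_mult_vec_index_sum[OF cut_matrix_carrier weight_vec_carrier i] by (rule sym)
  finally show ?thesis by (rule sym)
qed

lemma ex_weight_vec:
  assumes "x \<in> carrier_vec (n choose 2)"
  obtains w where "weight_vec n w = x"
proof
  \<comment> \<open>The position of a pair is unique because \<open>pair_list\<close> is distinct;
    values at other sets never enter \<open>weight_vec\<close>.\<close>
  let ?w = "\<lambda>e. x $ (THE j. j < n choose 2 \<and> pair_list n ! j = e)"
  have "(THE j'. j' < n choose 2 \<and> pair_list n ! j' = pair_list n ! j) = j"
    if "j < n choose 2" for j
    using that distinct_pair_list[of n] by (auto simp: nth_eq_iff_index_eq length_pair_list)
  thus "weight_vec n ?w = x" using assms by (intro eq_vecI) (auto simp: weight_vec_def)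
qed

lemma nonneg_weights_iff:
  "nonneg_weights n w \<longleftrightarrow> (\<forall>j<n choose 2. 0 \<le> weight_vec n w $ j)"
  unfolding nonneg_weights_def weight_vec_def set_pair_list[symmetric]
  by (auto simp: all_set_conv_all_nth length_pair_list)

lemma le_min_cut_iff_cut_matrix:
  assumes "2 \<le> n" and "nonneg_weights n w"
  shows "\<tau> \<le> min_cut n w \<longleftrightarrow>
    (\<forall>i<2 ^ (n - 1) - 1. \<tau> \<le> (cut_matrix n *\<^sub>v weight_vec n w) $ i)"
  unfolding le_min_cut_iff[OF assms(1)] all_set_conv_all_nth length_cut_list
  by (intro all_cong1 imp_cong refl) (simp only: cut_matrix_mult_weight_vec[OF assms(2)])

section \<open>Passing between certificates and admissible matrices\<close>

lemma at_least_certifies_factor: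
  assumes "2 \<le> n"
    and CD: "C \<in> carrier_mat (2 ^ (n - 1) - 1) r" "D \<in> carrier_mat r (n choose 2)"
    and le: "C * D \<le> cut_matrix n"
    and ge: "vec (2 ^ (n - 1) - 1) (\<lambda>_. \<tau>) \<le> C * D *\<^sub>v weight_vec n w"
  shows "at_least_certifies n w \<tau> D"
  unfolding at_least_certifies_def
proof (intro allI impI, elim conjE)
  fix w' assume w': "nonneg_weights n w'" and eq: "D *\<^sub>v weight_vec n w = D *\<^sub>v weight_vec n w'"
  let ?N = "2 ^ (n - 1) - 1 :: nat" and ?d = "n choose 2"
  have CDc: "C * D \<in> carrier_mat ?N ?d" using CD by simp
  \<comment> \<open>The factor \<open>C\<close> only recombines the answers given by
    \<open>D\<close>, on which the two graphs agree.\<close>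
  have same: "C * D *\<^sub>v weight_vec n w = C * D *\<^sub>v weight_vec n w'"
    using eq CD by (simp add: assoc_mult_mat_vec[of C ?N r D ?d])
  have "\<tau> \<le> (cut_matrix n *\<^sub>v weight_vec n w') $ i" if i: "i < ?N" for i
  proof -
    have "\<tau> \<le> (C * D *\<^sub>v weight_vec n w') $ i"
      using ge i CD unfolding same less_eq_vec_def by auto
    also have "\<dots> = (\<Sum>j<?d. (C * D) $$ (i, j) * weight_vec n w' $ j)"
      using CDc i by (intro mat_mult_vec_index_sum) auto
    \<comment> \<open>The entrywise bound survives multiplication because the weights of
      \<open>w'\<close> are non-negative.\<close>
    also have "\<dots> \<le> (\<Sum>j<?d. cut_matrix n $$ (i, j) * weight_vec n w' $ j)"
      using le i w' cut_matrix_carrier[of n] unfolding less_eq_mat_def nonneg_weights_iff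
      by (intro sum_mono mult_right_mono) auto
    also have "\<dots> = (cut_matrix n *\<^sub>v weight_vec n w') $ i"
      using mat_mult_vec_index_sum[OF cut_matrix_carrier weight_vec_carrier i] by (rule sym)
    finally show ?thesis .
  qed
  thus "\<tau> \<le> min_cut n w'" using le_min_cut_iff_cut_matrix[OF \<open>2 \<le> n\<close> w'] by blast
qed

text \<open>Row \<open>i\<close> of the multiplier is a dual optimum of the linear program that minimises the
  weight of cut \<open>i\<close> over all graphs which the certificate cannot tell apart from \<open>w\<close>.\<close>

lemma at_least_certifies_multiplier:
  assumes n: "2 \<le> n" and w: "nonneg_weights n w"
    and A: "A \<in> carrier_mat k (n choose 2)" and cert: "at_least_certifies n w \<tau> A"
  shows "\<exists>Y\<in>carrier_mat (2 ^ (n - 1) - 1) k. Y * A \<le> cut_matrix n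
    \<and> vec (2 ^ (n - 1) - 1) (\<lambda>_. \<tau>) \<le> Y * A *\<^sub>v weight_vec n w"
proof -
  let ?N = "2 ^ (n - 1) - 1 :: nat" and ?d = "n choose 2"
  have "\<exists>y. (\<forall>j\<in>{..<?d}. (\<Sum>l<k. y l * A $$ (l, j)) \<le> cut_matrix n $$ (i, j))
      \<and> \<tau> \<le> (\<Sum>j<?d. (\<Sum>l<k. y l * A $$ (l, j)) * weight_vec n w $ j)" if i: "i < ?N" for i
  proof (rule linear_program_dual)
    fix x :: "nat \<Rightarrow> real"
    assume x: "\<forall>j\<in>{..<?d}. 0 \<le> x j"
      and eq: "\<forall>l\<in>{..<k}. (\<Sum>j<?d. A $$ (l, j) * x j) = (\<Sum>j<?d. A $$ (l, j) * weight_vec n w $ j)"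
    \<comment> \<open>Each feasible point of the program is the weight vector of a graph, to which
      the certificate applies.\<close>
    obtain w' where w': "weight_vec n w' = vec ?d x" using ex_weight_vec[OF vec_carrier] .
    have nn: "nonneg_weights n w'" using x by (simp add: nonneg_weights_iff w')
    have "A *\<^sub>v weight_vec n w = A *\<^sub>v weight_vec n w'"
      using A eq unfolding w'
      by (intro eq_vecI) (auto simp: mat_mult_vec_index_sum[OF A] simp del: index_mult_mat_vec)
    with nn cert have "\<tau> \<le> min_cut n w'" unfolding at_least_certifies_def by blast
    hence "\<tau> \<le> (cut_matrix n *\<^sub>v weight_vec n w') $ i"
      using le_min_cut_iff_cut_matrix[OF n nn] i by blast
    thus "\<tau> \<le> (\<Sum>j<?d. cut_matrix n $$ (i, j) * x j)"
      using mat_mult_vec_index_sum[OF cut_matrix_carrier weight_vec_carrier i, of w']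
      by (simp add: w')
  qed (use w nonneg_weights_iff in auto)
  hence "\<forall>i\<in>{..<?N}. \<exists>y. (\<forall>j\<in>{..<?d}. (\<Sum>l<k. y l * A $$ (l, j)) \<le> cut_matrix n $$ (i, j))
      \<and> \<tau> \<le> (\<Sum>j<?d. (\<Sum>l<k. y l * A $$ (l, j)) * weight_vec n w $ j)"
    by blast
  from bchoice[OF this] obtain y where y: "\<forall>i\<in>{..<?N}.
      (\<forall>j\<in>{..<?d}. (\<Sum>l<k. y i l * A $$ (l, j)) \<le> cut_matrix n $$ (i, j))
      \<and> \<tau> \<le> (\<Sum>j<?d. (\<Sum>l<k. y i l * A $$ (l, j)) * weight_vec n w $ j)"
    by blast
  define Y where "Y = mat ?N k (\<lambda>(i, l). y i l)"
  have Y: "Y \<in> carrier_mat ?N k" by (simp add: Y_def)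
  have YA: "Y * A \<in> carrier_mat ?N ?d" using Y A by simp
  have ent: "(Y * A) $$ (i, j) = (\<Sum>l<k. y i l * A $$ (l, j))" if "i < ?N" "j < ?d" for i j
    using that A by (auto simp: Y_def scalar_prod_def atLeast0LessThan intro!: sum.cong)
  have "Y * A \<le> cut_matrix n"
    unfolding less_eq_mat_def carrier_matD[OF YA] carrier_matD[OF cut_matrix_carrier]
  proof (intro conjI allI impI refl)
    fix i j assume i: "i < ?N" and j: "j < ?d"
    show "(Y * A) $$ (i, j) \<le> cut_matrix n $$ (i, j)"
      unfolding ent[OF i j] using y i j by blast
  qed
  moreover have "vec ?N (\<lambda>_. \<tau>) \<le> Y * A *\<^sub>v weight_vec n w"
    unfolding less_eq_vec_def
  proof (intro conjI allI impI)
    fix i assume "i < dim_vec (Y * A *\<^sub>v weight_vec n w)"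
    hence i: "i < ?N" using YA by (simp only: dim_mult_mat_vec carrier_matD)
    have "(Y * A *\<^sub>v weight_vec n w) $ i
        = (\<Sum>j<?d. (\<Sum>l<k. y i l * A $$ (l, j)) * weight_vec n w $ j)"
      unfolding mat_mult_vec_index_sum[OF YA weight_vec_carrier i]
      by (intro sum.cong refl) (simp only: ent[OF i] lessThan_iff)
    also have "\<tau> \<le> \<dots>" using y i by blast
    finally show "vec ?N (\<lambda>_. \<tau>) $ i \<le> (Y * A *\<^sub>v weight_vec n w) $ i"
      using i by (simp only: index_vec)
  qed (use YA in \<open>simp only: dim_mult_mat_vec dim_vec carrier_matD\<close>)
  ultimately show ?thesis using Y by blast
qed

theorem theorem24:
  fixes n :: nat and w :: "nat set \<Rightarrow> real" and \<tau> :: real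
  assumes "2 \<le> n"
    and "nonneg_weights n w"
    and "0 \<le> \<tau>" and "\<tau> \<le> min_cut n w"
  shows "at_least_cert n w \<tau> = cut_rank n w \<tau>"
proof (rule antisym)
  let ?N = "2 ^ (n - 1) - 1 :: nat" and ?d = "n choose 2"
  let ?Q = "\<lambda>k. \<exists>A\<in>carrier_mat k ?d. at_least_certifies n w \<tau> A"
  let ?adm = "\<lambda>X. X \<le> cut_matrix n \<and> vec ?N (\<lambda>_. \<tau>) \<le> X *\<^sub>v weight_vec n w"
  let ?R = "\<lambda>r. \<exists>X\<in>carrier_mat ?N ?d. X \<le> cut_matrix n \<and> vec ?N (\<lambda>_. \<tau>) \<le> X *\<^sub>v weight_vec n w
    \<and> r = vec_space.rank ?N X"
  have QR: "?Q r" if "?R r" for r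
  proof -
    from that obtain X where X: "X \<in> carrier_mat ?N ?d" "?adm X" "r = vec_space.rank ?N X" by blast
    from vec_space.rank_factorization[OF X(1)] obtain C D
      where "C \<in> carrier_mat ?N r" "D \<in> carrier_mat r ?d" "X = C * D" unfolding X(3) by blast
    with X(2) at_least_certifies_factor[OF assms(1)] show ?thesis by blast
  qed
  \<comment> \<open>By \<open>\<tau> \<le> min_cut n w\<close> the cut matrix itself is admissible.
    Hence both minima range over nonempty sets, as \<open>LeastI\<close> requires.\<close>
  have adm: "?adm (cut_matrix n)"
    using assms cut_matrix_carrier[of n] le_min_cut_iff_cut_matrix[OF assms(1,2)]
    by (auto simp: less_eq_vec_def)
  hence R: "?R (vec_space.rank ?N (cut_matrix n))" using cut_matrix_carrier by blast
  have "?R (cut_rank n w \<tau>)" unfolding cut_rank_def by (rule LeastI[where P = ?R, OF R])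
  from QR[OF this] show "at_least_cert n w \<tau> \<le> cut_rank n w \<tau>"
    unfolding at_least_cert_def by (rule Least_le)
  have "?Q (at_least_cert n w \<tau>)"
    unfolding at_least_cert_def by (rule LeastI[where P = ?Q, OF QR[OF R]])
  then obtain A where A: "A \<in> carrier_mat (at_least_cert n w \<tau>) ?d" "at_least_certifies n w \<tau> A"
    by blast
  from at_least_certifies_multiplier[OF assms(1,2) A] obtain Y
    where Y: "Y \<in> carrier_mat ?N (at_least_cert n w \<tau>)" "?adm (Y * A)" by blast
  \<comment> \<open>The product factors through the rows of a smallest certificate, so its rank is
    at most their number.\<close>
  have "?R (vec_space.rank ?N (Y * A))"
    using Y(2) mult_carrier_mat[OF Y(1) A(1)] by (intro bexI[of _ "Y * A"] conjI refl) simp_all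
  hence "cut_rank n w \<tau> \<le> vec_space.rank ?N (Y * A)" unfolding cut_rank_def by (rule Least_le)
  also have "\<dots> \<le> at_least_cert n w \<tau>" by (rule vec_space.rank_mult_le[OF Y(1) A(1)])
  finally show "cut_rank n w \<tau> \<le> at_least_cert n w \<tau>" .
qed

end
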